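(* Consider the problems $(\mathcal P(\mathbf b,q))$, $(\mathcal P^r(\mathbf b,q))$ and $(\mathcal P^{\eta}(\mathbf b,q))$ described in the context. Let $(\breve{\mathbf x},\breve{\mathbf y},\breve\eta)\in\prod_{i=1}^m[0,R^i]\times\prod_{i=1}^m[0,b^i]\times\{0,1\}^m$ be a solution of the mixed-integer problem $(\mathcal P(\mathbf b,q))$ and let $(\bar{\mathbf x},\bar{\mathbf y},\bar\eta)\in\prod_{i=1}^m[0,R^i]\times\prod_{i=1}^m[0,b^i]\times[0,1]^m$ be a solution of the relaxed problem $(\mathcal P^r(\mathbf b,q))$. Let $(\tilde{\mathbf x},\tilde{\mathbf y},1_{\{\bar\eta>0\}})\in\prod_{i=1}^m[0,R^i]\times\prod_{i=1}^m[0,b^i]\times\{0,1\}^m$, where $(\tilde{\mathbf x},\tilde{\mathbf y})$ is a solution of $(\mathcal P^{\bar\eta}(\mathbf b,q))$. Then $$\left|h(\tilde{\mathbf x},\tilde{\mathbf y},\bar\eta)-h(\breve{\mathbf x},\breve{\mathbf y},\breve\eta)\right|\le\varepsilon(q,\bar\eta),$$ where $h(\mathbf x,\mathbf y,\eta):=u(A(\mathbf x-\mathbf y))-\sum_{i:\eta_i>0}q_i$ (which is the objective functional of $(\mathcal P(\mathbf b,q))$) and $$\varepsilon(q,\bar\eta)=q_{\max}\left(\|\bar\eta\|_0-\|\bar\eta\|_1\right)+(q_{\max}-q_{\min})\|\bar\eta\|_1;$$ that is, $(\tilde{\mathbf x},\tilde{\mathbf y},1_{\{\bar\eta>0\}})$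 is an $\varepsilon(q,\bar\eta)$-approximate solution of $(\mathcal P(\mathbf b,q))$.
   Context: Setting. $m\ge1$ markets (CFMMs), $n\ge2$ tokens; market $i$ trades $n_i\in\{2,\dots,n\}$ tokens. $A^i\in\{0,1\}^{n\times n_i}$ is the connectivity matrix: $A^i_{jk}=1$ if global token $j$ is the local token $k$ of market $i$, and $A^i_{jk}=0$ otherwise (distinct local tokens correspond to distinct global tokens). $R^i\in\mathbb R_+^{n_i}$ are the reserves, $\gamma_i\in\,]0,1[$, $\varphi_i:\mathbb R_+^{n_i}\to\mathbb R$ is the (differentiable) trade function, $u:\mathbb R^n\to\mathbb R$ is the (differentiable) utility, $q\in\mathbb R_+^m$ are the gas fees, $b^i\in\mathbb R_{++}^{n_i}$ are the activation bounds, $\mathbf b=(b^1,\dots,b^m)$. Here $\mathbb R_+=[0,\infty[$, $\mathbb R_{++}=\,]0,\infty[$, vector inequalities are componentwise, and $[0,R^i]=\{x:0\le x\le R^i\}$, similarly $[0,b^i]$. Write $\mathbf x=(x^1,\dots,x^m)$, $\mathbf y=(y^1,\dots,y^m)$ with $x^i,y^i\in\mathbb R^{n_i}$, $\eta=(\eta_1,\dots,\eta_m)$, $A(\mathbf x)=\sum_{i=1}^mA^ix^i$. Mixed-integer problem $(\mathcal P(\mathbf b,q))$: maximize $u(A(\mathbf x-\mathbf y))-\langle q,\eta\rangle$ subject to, for all $i$: $\varphi_i(R^i+\gamma_iy^i-x^i)=\varphi_i(R^i)$, $0\le x^i\le R^i$, $0\le y^i\le\eta_ib^i$, $\eta_i\in\{0,1\}$.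 Relaxed problem $(\mathcal P^r(\mathbf b,q))$: the same with $\eta_i\in\{0,1\}$ replaced by $0\le\eta_i\le1$. Problem $(\mathcal P^{\eta}(\mathbf b,q))$ for given $\eta\in[0,1]^m$: maximize $u(A(\mathbf x-\mathbf y))$ over $(\mathbf x,\mathbf y)$ subject to, for all $i$: $\varphi_i(R^i+\gamma_iy^i-x^i)=\varphi_i(R^i)$, $0\le x^i\le R^i$, $0\le y^i\le1_{\{\eta_i>0\}}b^i$. Solutions are global maximizers. $1_{\{\eta>0\}}\in\{0,1\}^m$ has $i$-th component $1$ if $\eta_i>0$ and $0$ otherwise. $q_{\max}=\max_iq_i$, $q_{\min}=\min_iq_i$, $\|\eta\|_0=\#\{i:\eta_i>0\}$, $\|\eta\|_1=\sum_i|\eta_i|$. An $\varepsilon$-approximate solution of a maximization problem is a feasible point whose objective value is within $\varepsilon$ of the optimal value. *)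

theory Defs
  imports Complex_Main "Jordan_Normal_Form.Matrix"
begin

text \<open>
  The numbers of local tokens vary with the market, so vectors carry their dimension in the term.
  On these vectors \<open>\<le>\<close> is the componentwise order and entails equality of dimensions;
  thus \<open>x \<in> {0\<^sub>v k..c}\<close> says that \<open>x\<close> lies in the \<open>k\<close>-dimensional box \<open>[0, c]\<close>.
  Markets are indexed by \<open>i < m\<close>.  A tuple of trades is a function \<open>nat \<Rightarrow> real vec\<close>, of which only
  the values at \<open>i < m\<close> matter.
\<close>

definition nonneg_orthant :: "nat \<Rightarrow> real vec set" where
  "nonneg_orthant k = {v \<in> carrier_vec k. \<forall>j<k. 0 \<le> v $ j}"

definition pos_orthant :: "nat \<Rightarrow> real vec set" where
  "pos_orthant k = {v \<in> carrier_vec k. \<forall>j<k. 0 < v $ j}"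

definition vec_norm2 :: "real vec \<Rightarrow> real" where
  "vec_norm2 v = sqrt (v \<bullet> v)"

text \<open>
  Frechet differentiability relative to the set \<open>S\<close>; \<open>g\<close> is a gradient at \<open>v\<close>.
  It is spelled out because the type of vectors of arbitrary dimension is not a normed space.
\<close>

definition vec_differentiable_on :: "nat \<Rightarrow> (real vec \<Rightarrow> real) \<Rightarrow> real vec set \<Rightarrow> bool" where
  "vec_differentiable_on k f S \<longleftrightarrow>
     (\<forall>v\<in>S. \<exists>g\<in>carrier_vec k. \<forall>e>0. \<exists>r>0. \<forall>w\<in>S. vec_norm2 (w - v) < r \<longrightarrow>
        \<bar>f w - f v - g \<bullet> (w - v)\<bar> \<le> e * vec_norm2 (w - v))"

text \<open>\<open>t k\<close> is the global token that is the local token \<open>k\<close> of the market.\<close>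

definition connectivity_matrix :: "nat \<Rightarrow> nat \<Rightarrow> real mat \<Rightarrow> bool" where
  "connectivity_matrix n k A \<longleftrightarrow>
     (\<exists>t. t \<in> {..<k} \<rightarrow> {..<n} \<and> inj_on t {..<k} \<and>
          A = mat n k (\<lambda>(j, l). if j = t l then 1 else 0))"

definition aggregate :: "nat \<Rightarrow> nat \<Rightarrow> (nat \<Rightarrow> real mat) \<Rightarrow> (nat \<Rightarrow> real vec) \<Rightarrow> real vec" where
  "aggregate n m A x = finsum_vec TYPE(real) n (\<lambda>i. A i *\<^sub>v x i) {..<m}"

definition market_feasible ::
  "nat \<Rightarrow> real vec \<Rightarrow> real \<Rightarrow> (real vec \<Rightarrow> real) \<Rightarrow> real vec \<Rightarrow> real vec \<Rightarrow> real vec \<Rightarrow> bool" where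
  "market_feasible k R \<gamma> \<phi> c x y \<longleftrightarrow>
     \<phi> (R + \<gamma> \<cdot>\<^sub>v y - x) = \<phi> R \<and> x \<in> {0\<^sub>v k..R} \<and> y \<in> {0\<^sub>v k..c}"

definition mixed_feasible ::
  "nat \<Rightarrow> (nat \<Rightarrow> nat) \<Rightarrow> (nat \<Rightarrow> real vec) \<Rightarrow> (nat \<Rightarrow> real) \<Rightarrow> (nat \<Rightarrow> real vec \<Rightarrow> real) \<Rightarrow>
   (nat \<Rightarrow> real vec) \<Rightarrow> ((nat \<Rightarrow> real vec) \<times> (nat \<Rightarrow> real vec) \<times> real vec) set" where
  "mixed_feasible m d R \<gamma> \<phi> b =
     {(x, y, \<eta>). \<eta> \<in> carrier_vec m \<and>
        (\<forall>i<m. market_feasible (d i) (R i) (\<gamma> i) (\<phi> i) (\<eta> $ i \<cdot>\<^sub>v b i) (x i) (y i) \<and>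
               \<eta> $ i \<in> {0, 1})}"

definition relaxed_feasible ::
  "nat \<Rightarrow> (nat \<Rightarrow> nat) \<Rightarrow> (nat \<Rightarrow> real vec) \<Rightarrow> (nat \<Rightarrow> real) \<Rightarrow> (nat \<Rightarrow> real vec \<Rightarrow> real) \<Rightarrow>
   (nat \<Rightarrow> real vec) \<Rightarrow> ((nat \<Rightarrow> real vec) \<times> (nat \<Rightarrow> real vec) \<times> real vec) set" where
  "relaxed_feasible m d R \<gamma> \<phi> b =
     {(x, y, \<eta>). \<eta> \<in> carrier_vec m \<and>
        (\<forall>i<m. market_feasible (d i) (R i) (\<gamma> i) (\<phi> i) (\<eta> $ i \<cdot>\<^sub>v b i) (x i) (y i) \<and>
               \<eta> $ i \<in> {0..1})}"

definition pos_indicator :: "nat \<Rightarrow> real vec \<Rightarrow> real vec" where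
  "pos_indicator m \<eta> = vec m (\<lambda>i. if \<eta> $ i > 0 then 1 else 0)"

definition fixed_feasible ::
  "nat \<Rightarrow> (nat \<Rightarrow> nat) \<Rightarrow> (nat \<Rightarrow> real vec) \<Rightarrow> (nat \<Rightarrow> real) \<Rightarrow> (nat \<Rightarrow> real vec \<Rightarrow> real) \<Rightarrow>
   (nat \<Rightarrow> real vec) \<Rightarrow> real vec \<Rightarrow> ((nat \<Rightarrow> real vec) \<times> (nat \<Rightarrow> real vec)) set" where
  "fixed_feasible m d R \<gamma> \<phi> b \<eta> =
     {(x, y). \<forall>i<m. market_feasible (d i) (R i) (\<gamma> i) (\<phi> i)
                      (pos_indicator m \<eta> $ i \<cdot>\<^sub>v b i) (x i) (y i)}"

definition trade_utility ::
  "nat \<Rightarrow> nat \<Rightarrow> (nat \<Rightarrow> real mat) \<Rightarrow> (real vec \<Rightarrow> real) \<Rightarrow>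
   (nat \<Rightarrow> real vec) \<times> (nat \<Rightarrow> real vec) \<Rightarrow> real" where
  "trade_utility n m A u = (\<lambda>(x, y). u (aggregate n m A (\<lambda>i. x i - y i)))"

definition gas_objective ::
  "nat \<Rightarrow> nat \<Rightarrow> (nat \<Rightarrow> real mat) \<Rightarrow> (real vec \<Rightarrow> real) \<Rightarrow> real vec \<Rightarrow>
   (nat \<Rightarrow> real vec) \<times> (nat \<Rightarrow> real vec) \<times> real vec \<Rightarrow> real" where
  "gas_objective n m A u q = (\<lambda>(x, y, \<eta>). trade_utility n m A u (x, y) - q \<bullet> \<eta>)"

definition h_value ::
  "nat \<Rightarrow> nat \<Rightarrow> (nat \<Rightarrow> real mat) \<Rightarrow> (real vec \<Rightarrow> real) \<Rightarrow> real vec \<Rightarrow>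
   (nat \<Rightarrow> real vec) \<times> (nat \<Rightarrow> real vec) \<times> real vec \<Rightarrow> real" where
  "h_value n m A u q =
     (\<lambda>(x, y, \<eta>). trade_utility n m A u (x, y) - (\<Sum>i | i < m \<and> \<eta> $ i > 0. q $ i))"

definition is_solution :: "('a \<Rightarrow> real) \<Rightarrow> 'a set \<Rightarrow> 'a \<Rightarrow> bool" where
  "is_solution f F z \<longleftrightarrow> is_arg_max f (\<lambda>w. w \<in> F) z"

definition is_approx_solution :: "real \<Rightarrow> ('a \<Rightarrow> real) \<Rightarrow> 'a set \<Rightarrow> 'a \<Rightarrow> bool" where
  "is_approx_solution e f F z \<longleftrightarrow>
     z \<in> F \<and> bdd_above (f ` F) \<and> \<bar>(SUP w\<in>F. f w) - f z\<bar> \<le> e"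

definition q_max :: "nat \<Rightarrow> real vec \<Rightarrow> real" where
  "q_max m q = Max ((\<lambda>i. q $ i) ` {..<m})"

definition q_min :: "nat \<Rightarrow> real vec \<Rightarrow> real" where
  "q_min m q = Min ((\<lambda>i. q $ i) ` {..<m})"

definition count_pos :: "nat \<Rightarrow> real vec \<Rightarrow> nat" where
  "count_pos m \<eta> = card {i. i < m \<and> \<eta> $ i > 0}"

definition vec_norm1 :: "nat \<Rightarrow> real vec \<Rightarrow> real" where
  "vec_norm1 m \<eta> = (\<Sum>i<m. \<bar>\<eta> $ i\<bar>)"

definition gap_bound :: "nat \<Rightarrow> real vec \<Rightarrow> real vec \<Rightarrow> real" where
  "gap_bound m q \<eta> =
     q_max m q * (real (count_pos m \<eta>) - vec_norm1 m \<eta>) + (q_max m q - q_min m q) * vec_norm1 m \<eta>"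

end

(*
  The mixed-integer feasible set lies in the relaxed one, so the relaxed optimal value bounds the
  mixed-integer one from above.  Rounding the relaxed activations up to 1 enlarges the trade bounds,
  so the relaxed trades compete in the problem with fixed activations and the utility does not
  decrease.  Only the additional gas fees, the sum of q_i (1 - eta_i) over the active markets, are
  lost, and they are at most q_max (||eta||_0 - ||eta||_1).
*)
theory Submission
  imports Defs
begin

lemma is_solution_iff: "is_solution f F z \<longleftrightarrow> z \<in> F \<and> (\<forall>w\<in>F. f w \<le> f z)"
  by (auto simp: is_solution_def is_arg_max_def not_less)

text \<open>A maximizer \<open>s\<close> bounds the image of \<open>F\<close> and attains its
  supremum. The gap between the supremum and \<open>f z\<close> is therefore
  \<open>f s - f z\<close>, which is nonnegative, so a one-sided estimate suffices.\<close>

lemma is_approx_solutionI: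
  assumes "is_solution f F s" and "z \<in> F" and "f s - f z \<le> e"
  shows "is_approx_solution e f F z"
proof -
  have max: "s \<in> F" "\<And>w. w \<in> F \<Longrightarrow> f w \<le> f s"
    using assms(1) by (auto simp: is_solution_iff)
  then have "(SUP w\<in>F. f w) = f s"
    by (intro cSup_eq_maximum) auto
  moreover have "bdd_above (f ` F)"
    using max(2) by (intro bdd_aboveI2)
  ultimately show ?thesis
    using assms max(2)[of z] by (simp add: is_approx_solution_def)
qed

lemma market_feasible_mono:
  assumes "market_feasible k R \<gamma> \<phi> c x y" and "c \<le> c'"
  shows "market_feasible k R \<gamma> \<phi> c' x y"
  using assms unfolding market_feasible_def by (auto intro: order_trans)

lemma smult_vec_right_mono:
  fixes b :: "real vec"
  assumes "b \<in> pos_orthant k" and "s \<le> t"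
  shows "s \<cdot>\<^sub>v b \<le> t \<cdot>\<^sub>v b"
  using assms by (auto simp: pos_orthant_def less_eq_vec_def intro!: mult_right_mono dest: less_imp_le)

text \<open>The entries of an indicator are 0 or 1, so integrality is automatic and only the market
  constraints remain. This turns a solution with fixed activations into a candidate for the
  mixed-integer problem.\<close>

lemma pos_indicator_mixed_feasible_iff:
  "(x, y, pos_indicator m \<eta>) \<in> mixed_feasible m d R \<gamma> \<phi> b \<longleftrightarrow>
   (x, y) \<in> fixed_feasible m d R \<gamma> \<phi> b \<eta>"
  by (auto simp: mixed_feasible_def fixed_feasible_def pos_indicator_def)

lemma mixed_feasible_subset_relaxed_feasible:
  "mixed_feasible m d R \<gamma> \<phi> b \<subseteq> relaxed_feasible m d R \<gamma> \<phi> b"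
  by (force simp: mixed_feasible_def relaxed_feasible_def)

lemma fixed_feasible_of_relaxed_feasible:
  assumes "(x, y, \<eta>) \<in> relaxed_feasible m d R \<gamma> \<phi> b"
    and "\<And>i. i < m \<Longrightarrow> b i \<in> pos_orthant (d i)"
  shows "(x, y) \<in> fixed_feasible m d R \<gamma> \<phi> b \<eta>"
proof -
  have "market_feasible (d i) (R i) (\<gamma> i) (\<phi> i) (pos_indicator m \<eta> $ i \<cdot>\<^sub>v b i) (x i) (y i)"
    if "i < m" for i
  proof (rule market_feasible_mono)
    show "market_feasible (d i) (R i) (\<gamma> i) (\<phi> i) (\<eta> $ i \<cdot>\<^sub>v b i) (x i) (y i)"
      using assms(1) that by (simp add: relaxed_feasible_def)
    \<comment> \<open>An active market has \<open>\<eta> $ i \<le> 1\<close>; an inactive one has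
      the value 0 on both sides.\<close>
    have "\<eta> $ i \<le> pos_indicator m \<eta> $ i"
      using assms(1) that by (simp add: relaxed_feasible_def pos_indicator_def)
    then show "\<eta> $ i \<cdot>\<^sub>v b i \<le> pos_indicator m \<eta> $ i \<cdot>\<^sub>v b i"
      using assms(2) that by (rule_tac smult_vec_right_mono)
  qed
  then show ?thesis
    by (simp add: fixed_feasible_def)
qed

lemma scalar_prod_pos_indicator:
  "q \<bullet> pos_indicator m \<eta> = (\<Sum>i | i < m \<and> \<eta> $ i > 0. q $ i)"
proof -
  have "q \<bullet> pos_indicator m \<eta> = (\<Sum>i<m. if \<eta> $ i > 0 then q $ i else 0)"
    by (auto simp: scalar_prod_def pos_indicator_def atLeast0LessThan intro!: sum.cong)
  also have "\<dots> = (\<Sum>i | i < m \<and> \<eta> $ i > 0. q $ i)"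
    by (simp add: sum.If_cases Int_def)
  finally show ?thesis .
qed

text \<open>\<open>h_value\<close> sees the activations only through their support, so evaluating it
  at fractional activations already charges the full fee of every active market.\<close>

lemma h_value_eq_gas_objective_pos_indicator:
  "h_value n m A u q (x, y, \<eta>) = gas_objective n m A u q (x, y, pos_indicator m \<eta>)"
  by (simp add: h_value_def gas_objective_def scalar_prod_pos_indicator)

text \<open>A vector with entries 0 and 1 is its own indicator.\<close>

lemma h_value_eq_gas_objective:
  assumes "z \<in> mixed_feasible m d R \<gamma> \<phi> b"
  shows "h_value n m A u q z = gas_objective n m A u q z"
proof -
  obtain x y \<eta> where z: "z = (x, y, \<eta>)"
    by (cases z)
  have "\<eta> \<in> carrier_vec m" "\<And>i. i < m \<Longrightarrow> \<eta> $ i \<in> {0, 1}"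
    using assms by (auto simp: z mixed_feasible_def)
  then have "pos_indicator m \<eta> = \<eta>"
    by (intro eq_vecI) (force simp: pos_indicator_def)+
  then show ?thesis
    by (simp add: z h_value_eq_gas_objective_pos_indicator)
qed

text \<open>Rounding up costs \<open>q $ i * (1 - \<eta> $ i)\<close> on each active market. Since
  the second factor is nonnegative, \<open>q $ i\<close> may be replaced by
  \<open>q_max m q\<close>; summation gives the first term of \<open>gap_bound\<close>.\<close>

lemma rounding_cost_le_gap_bound:
  assumes "m \<ge> 1" and "\<eta> \<in> carrier_vec m" and "\<And>i. i < m \<Longrightarrow> \<eta> $ i \<in> {0..1}"
  shows "q \<bullet> pos_indicator m \<eta> - q \<bullet> \<eta> \<le> gap_bound m q \<eta>"
proof -
  define S where "S = {i. i < m \<and> \<eta> $ i > 0}"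
  have S: "finite S" "S \<subseteq> {..<m}"
    by (auto simp: S_def)
  \<comment> \<open>Outside \<open>S\<close> the entries of \<open>\<eta>\<close> are 0, being
    nonnegative but not positive. The weight \<open>f\<close> is left free to serve both the fees
    and, with \<open>f = 1\<close>, the norm.\<close>
  have supp: "(\<Sum>i<m. f i * \<eta> $ i) = (\<Sum>i\<in>S. f i * \<eta> $ i)" for f :: "nat \<Rightarrow> real"
    using assms(3) S by (intro sum.mono_neutral_right) (force simp: S_def)+
  have norm1: "vec_norm1 m \<eta> = (\<Sum>i\<in>S. \<eta> $ i)"
    using assms(3) supp[of "\<lambda>_. 1"] by (simp add: vec_norm1_def)
  have "q \<bullet> \<eta> = (\<Sum>i<m. q $ i * \<eta> $ i)"
    using assms(2) by (simp add: scalar_prod_def atLeast0LessThan)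
  then have "q \<bullet> pos_indicator m \<eta> - q \<bullet> \<eta> = (\<Sum>i\<in>S. q $ i * (1 - \<eta> $ i))"
    by (simp add: scalar_prod_pos_indicator supp sum_subtractf right_diff_distrib flip: S_def)
  also have "\<dots> \<le> (\<Sum>i\<in>S. q_max m q * (1 - \<eta> $ i))"
    using assms(3) S by (intro sum_mono mult_right_mono) (auto simp: q_max_def)
  also have "\<dots> = q_max m q * (real (count_pos m \<eta>) - vec_norm1 m \<eta>)"
    by (simp add: norm1 count_pos_def sum_subtractf flip: sum_distrib_left S_def)
  also have "\<dots> \<le> gap_bound m q \<eta>"
  proof -
    \<comment> \<open>Market 0 exists because \<open>m \<ge> 1\<close>; it links the two extremal
      fees, so the second term of \<open>gap_bound\<close> is nonnegative.\<close>
    have "q_min m q \<le> q $ 0" "q $ 0 \<le> q_max m q"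
      using assms(1) by (auto simp: q_min_def q_max_def)
    moreover have "0 \<le> vec_norm1 m \<eta>"
      by (simp add: vec_norm1_def sum_nonneg)
    ultimately show ?thesis
      by (simp add: gap_bound_def)
  qed
  finally show ?thesis .
qed

theorem theorem3p4:
  fixes m n :: nat
    and d :: "nat \<Rightarrow> nat"
    and A :: "nat \<Rightarrow> real mat"
    and R b :: "nat \<Rightarrow> real vec"
    and \<gamma> :: "nat \<Rightarrow> real"
    and \<phi> :: "nat \<Rightarrow> real vec \<Rightarrow> real"
    and u :: "real vec \<Rightarrow> real"
    and q :: "real vec"
    and xm ym xr yr xt yt :: "nat \<Rightarrow> real vec"
    and \<eta>m \<eta>r :: "real vec"
  assumes "m \<ge> 1" and "n \<ge> 2"
    and "\<And>i. i < m \<Longrightarrow> d i \<in> {2..n}"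
    and "\<And>i. i < m \<Longrightarrow> connectivity_matrix n (d i) (A i)"
    and "\<And>i. i < m \<Longrightarrow> R i \<in> nonneg_orthant (d i)"
    and "\<And>i. i < m \<Longrightarrow> \<gamma> i \<in> {0<..<1}"
    and "\<And>i. i < m \<Longrightarrow> vec_differentiable_on (d i) (\<phi> i) (nonneg_orthant (d i))"
    and "vec_differentiable_on n u (carrier_vec n)"
    and "q \<in> nonneg_orthant m"
    and "\<And>i. i < m \<Longrightarrow> b i \<in> pos_orthant (d i)"
    and "is_solution (gas_objective n m A u q) (mixed_feasible m d R \<gamma> \<phi> b) (xm, ym, \<eta>m)"
    and "is_solution (gas_objective n m A u q) (relaxed_feasible m d R \<gamma> \<phi> b) (xr, yr, \<eta>r)"
    and "is_solution (trade_utility n m A u) (fixed_feasible m d R \<gamma> \<phi> b \<eta>r) (xt, yt)"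
  shows "(\<forall>z \<in> mixed_feasible m d R \<gamma> \<phi> b. h_value n m A u q z = gas_objective n m A u q z) \<and>
         \<bar>h_value n m A u q (xt, yt, \<eta>r) - h_value n m A u q (xm, ym, \<eta>m)\<bar> \<le> gap_bound m q \<eta>r \<and>
         is_approx_solution (gap_bound m q \<eta>r) (gas_objective n m A u q)
           (mixed_feasible m d R \<gamma> \<phi> b) (xt, yt, pos_indicator m \<eta>r)"
proof -
  let ?g = "gas_objective n m A u q"
  let ?M = "mixed_feasible m d R \<gamma> \<phi> b"
  let ?t = "(xt, yt, pos_indicator m \<eta>r)"
  have m: "(xm, ym, \<eta>m) \<in> ?M" "\<And>w. w \<in> ?M \<Longrightarrow> ?g w \<le> ?g (xm, ym, \<eta>m)"
    using assms(11) by (auto simp: is_solution_iff)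
  have r: "(xr, yr, \<eta>r) \<in> relaxed_feasible m d R \<gamma> \<phi> b"
    "\<And>w. w \<in> relaxed_feasible m d R \<gamma> \<phi> b \<Longrightarrow> ?g w \<le> ?g (xr, yr, \<eta>r)"
    using assms(12) by (auto simp: is_solution_iff)
  have t: "?t \<in> ?M"
    using assms(13) by (simp add: is_solution_iff pos_indicator_mixed_feasible_iff)
  have "?g (xm, ym, \<eta>m) \<le> ?g (xr, yr, \<eta>r)"
    using m(1) r(2) mixed_feasible_subset_relaxed_feasible by blast
  moreover have "trade_utility n m A u (xr, yr) \<le> trade_utility n m A u (xt, yt)"
    using assms(13) fixed_feasible_of_relaxed_feasible[OF r(1) assms(10)]
    by (simp add: is_solution_iff)
  moreover have "q \<bullet> pos_indicator m \<eta>r - q \<bullet> \<eta>r \<le> gap_bound m q \<eta>r"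
    using r(1) by (intro rounding_cost_le_gap_bound[OF assms(1)]) (auto simp: relaxed_feasible_def)
  \<comment> \<open>With \<open>U\<close> for the utility, the chain is \<open>?g (xm, ym, \<eta>m)
    \<le> U (xr, yr) - q \<bullet> \<eta>r \<le> U (xt, yt) - q \<bullet> \<eta>r\<close>, and the
    last value exceeds \<open>?g ?t\<close> by exactly the rounding cost.\<close>
  ultimately have gap: "?g (xm, ym, \<eta>m) - ?g ?t \<le> gap_bound m q \<eta>r"
    by (simp add: gas_objective_def)
  have "h_value n m A u q (xt, yt, \<eta>r) = ?g ?t"
    by (rule h_value_eq_gas_objective_pos_indicator)
  moreover have "h_value n m A u q (xm, ym, \<eta>m) = ?g (xm, ym, \<eta>m)"
    using m(1) by (rule h_value_eq_gas_objective)
  \<comment> \<open>Feasibility of \<open>?t\<close> gives the other sign: its value cannot exceed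
    the mixed-integer optimum, so \<open>gap\<close> bounds the absolute value.\<close>
  ultimately have "\<bar>h_value n m A u q (xt, yt, \<eta>r) - h_value n m A u q (xm, ym, \<eta>m)\<bar>
      \<le> gap_bound m q \<eta>r"
    using gap m(2)[OF t] by simp
  then show ?thesis
    using h_value_eq_gas_objective is_approx_solutionI[OF assms(11) t gap] by blast
qed

end
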